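(* Let $g\geq 1$. Let $\mathcal{X}_3\cap\mathfrak{h}_g$ be the set of symplectic lattices in the Siegel space $\mathfrak{h}_g=\mathrm{Sp}(2g,\mathbb{R})/\mathrm{U}(g)$ whose systoles (minimal vectors) generate a vector subspace of dimension at least $3$ in $\mathbb{R}^{2g}$. Then $\mathcal{X}_3\cap\mathfrak{h}_g$ does not contain any model for $\underline{E}\mathrm{Sp}(2g,\mathbb{Z})$; that is, no $\mathrm{Sp}(2g,\mathbb{Z})$-invariant subspace $W\subset\mathcal{X}_3\cap\mathfrak{h}_g$ is a model for $\underline{E}\mathrm{Sp}(2g,\mathbb{Z})$. In particular, $\mathcal{X}_3\cap\mathfrak{h}_g$ does not contain any $\mathrm{Sp}(2g,\mathbb{Z})$-equivariant deformation retract of $\mathfrak{h}_g$.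
   Context: Models for $\underline{E}\Gamma$: for an infinite discrete group $\Gamma$, a model for $\underline{E}\Gamma$ (classifying space for proper actions) is a $\Gamma$-CW-complex $W$ such that for every subgroup $H\subset\Gamma$ the fixed point set $W^H$ is contractible (in particular non-empty) if $H$ is finite, and empty if $H$ is infinite. Symplectic group: $\mathrm{Sp}(2g,\mathbb{R})$ is the group of real $2g\times 2g$ matrices $A$ with ${}^tAJA=J$, where $J$ is block-diagonal with $g$ diagonal blocks equal to $\begin{pmatrix}0&-1\\1&0\end{pmatrix}$; $\mathrm{Sp}(2g,\mathbb{Z})$ is its subgroup of integer matrices, and $\mathrm{U}(g)=\mathrm{Sp}(2g,\mathbb{R})\cap\mathrm{SO}(2g)$ is a maximal compact subgroup. Siegel space as a space of lattices: $\mathfrak{h}_g=\mathrm{Sp}(2g,\mathbb{R})/\mathrm{U}(g)$ is identified with the space of symplectic lattices $\Lambda=A\mathbb{Z}^{2g}$, $A\in\mathrm{Sp}(2g,\mathbb{R})$, endowed with the symplectic $\mathbb{Z}$-basis given by the columns of $A$, modulo isometries (i.e. $A$ is taken modulo left multiplication by $\mathrm{U}(g)$). Explicitly, the coset $h\,\mathrm{U}(g)$ corresponds to the class of $A=h^{-1}$, so that left translation by $\gamma\in\mathrm{Sp}(2g,\mathbb{Z})$ corresponds to the change of basis $A\mapsto A\gamma^{-1}$. This is the action of $\mathrm{Sp}(2g,\mathbb{Z})$ on $\mathfrak{h}_g$. Systoles: for $\Lambda=A\mathbb{Z}^{2g}$, $\mathrm{syst}(\Lambda)=\min_{v\in\mathbb{Z}^{2g}\setminus\{0\}}|Av|$,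 with $|\cdot|$ the Euclidean norm. The vectors $v$ realizing this minimum are called the systoles, or minimal vectors, of $\Lambda$. The dimension of the subspace they generate depends only on the point of $\mathfrak{h}_g$. A $\Gamma$-equivariant deformation retract of a $\Gamma$-space $X$ is a $\Gamma$-invariant subspace $W\subset X$ onto which $X$ deformation retracts through $\Gamma$-equivariant maps. *)

theory Defs
  imports "HOL-Analysis.Analysis" "HOL-Algebra.Left_Coset" "HOL-Algebra.Group_Action"
begin

section \<open>Proper classifying spaces\<close>

definition G_space :: "('g, 'm) monoid_scheme \<Rightarrow> 'x topology \<Rightarrow> ('g \<Rightarrow> 'x \<Rightarrow> 'x) \<Rightarrow> bool" where
  "G_space G X \<phi> \<longleftrightarrow>
     group_action G (topspace X) \<phi> \<and> (\<forall>\<gamma>\<in>carrier G. continuous_map X X (\<phi> \<gamma>))"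

text \<open>The unit ball of dimension \<open>n\<close> and its boundary. In dimension 0 they are a point and
  the empty set.\<close>

definition disc :: "nat \<Rightarrow> (nat \<Rightarrow> real) topology" where
  "disc n = subtopology (Euclidean_space n) {x. (\<Sum>i<n. (x i)\<^sup>2) \<le> 1}"

definition disc_boundary :: "nat \<Rightarrow> (nat \<Rightarrow> real) set" where
  "disc_boundary n = {x \<in> topspace (disc n). (\<Sum>i<n. (x i)\<^sup>2) = 1}"

text \<open>The coproduct over \<open>j \<in> J\<close> of the \<open>G\<close>-spaces \<open>G/H\<^sub>j \<times> D\<^sup>n\<close>; its points are
  triples \<open>(j, c, d)\<close>, where \<open>c\<close> is a left coset of \<open>H\<^sub>j\<close>.\<close>

definition equivariant_cells ::
  "('g, 'm) monoid_scheme \<Rightarrow> 'j set \<Rightarrow> ('j \<Rightarrow> 'g set) \<Rightarrow> nat \<Rightarrow>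
     ('j \<times> 'g set \<times> (nat \<Rightarrow> real)) topology" where
  "equivariant_cells G J H n =
     sum_topology (\<lambda>j. prod_topology (discrete_topology (lcosets\<^bsub>G\<^esub> (H j))) (disc n)) J"

text \<open>\<open>B\<close> is obtained from \<open>A\<close> by attaching the equivariant \<open>n\<close>-cells \<open>G/H\<^sub>j \<times> D\<^sup>n\<close>, with
  characteristic maps \<open>Q\<close>. The last two conjuncts say that the square formed by the coproducts
  of the \<open>G/H\<^sub>j \<times> S\<^bsup>n-1\<^esup>\<close> and of the \<open>G/H\<^sub>j \<times> D\<^sup>n\<close>, by \<open>A\<close> and by \<open>B\<close> is a pushout: \<open>B\<close> is, as
  a set, the disjoint union of \<open>A\<close> and the open cells, and it carries the final topology with
  respect to \<open>Q\<close> and to the inclusion of \<open>A\<close>. In particular \<open>Q\<close> is continuous.\<close>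

definition attaches_equivariant_cells ::
  "('g, 'm) monoid_scheme \<Rightarrow> 'x topology \<Rightarrow> ('g \<Rightarrow> 'x \<Rightarrow> 'x) \<Rightarrow> nat \<Rightarrow> 'x set \<Rightarrow> 'x set \<Rightarrow>
     'j set \<Rightarrow> ('j \<Rightarrow> 'g set) \<Rightarrow> ('j \<times> 'g set \<times> (nat \<Rightarrow> real) \<Rightarrow> 'x) \<Rightarrow> bool" where
  "attaches_equivariant_cells G X \<phi> n A B J H Q \<longleftrightarrow>
     A \<subseteq> B \<and>
     (\<forall>j\<in>J. subgroup (H j) G) \<and>
     (\<forall>j\<in>J. \<forall>c\<in>lcosets\<^bsub>G\<^esub> (H j). \<forall>d\<in>topspace (disc n). \<forall>\<gamma>\<in>carrier G.
        Q (j, \<gamma> <#\<^bsub>G\<^esub> c, d) = \<phi> \<gamma> (Q (j, c, d))) \<and>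
     (\<forall>j\<in>J. \<forall>c\<in>lcosets\<^bsub>G\<^esub> (H j). \<forall>d\<in>disc_boundary n. Q (j, c, d) \<in> A) \<and>
     bij_betw Q (SIGMA j:J. (lcosets\<^bsub>G\<^esub> (H j)) \<times> (topspace (disc n) - disc_boundary n)) (B - A) \<and>
     (\<forall>U\<subseteq>B. openin (subtopology X B) U \<longleftrightarrow>
        openin (subtopology X A) (U \<inter> A) \<and>
        openin (equivariant_cells G J H n)
          {p \<in> topspace (equivariant_cells G J H n). Q p \<in> U})"

text \<open>\<open>G\<close>-CW-complexes, for a discrete group \<open>G\<close>. The filtration is indexed so that \<open>Sk 0 = {}\<close>
  is the skeleton of dimension \<open>-1\<close> and \<open>Sk (Suc n)\<close> the one of dimension \<open>n\<close>. Taking the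
  points of \<open>X\<close> as labels of the cells is no restriction, since an equivariant cell can be
  labelled by the centre of one of its discs.\<close>

definition G_CW_complex :: "('g, 'm) monoid_scheme \<Rightarrow> 'x topology \<Rightarrow> ('g \<Rightarrow> 'x \<Rightarrow> 'x) \<Rightarrow> bool" where
  "G_CW_complex G X \<phi> \<longleftrightarrow>
     G_space G X \<phi> \<and>
     (\<exists>Sk :: nat \<Rightarrow> 'x set.
        Sk 0 = {} \<and>
        (\<forall>n. \<forall>\<gamma>\<in>carrier G. \<phi> \<gamma> ` Sk n \<subseteq> Sk n) \<and>
        (\<Union>n. Sk n) = topspace X \<and>
        (\<forall>U\<subseteq>topspace X. openin X U \<longleftrightarrow> (\<forall>n. openin (subtopology X (Sk n)) (U \<inter> Sk n))) \<and>
        (\<forall>n. \<exists>(J :: 'x set) H Q.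
           attaches_equivariant_cells G X \<phi> n (Sk n) (Sk (Suc n)) J H Q))"

definition fixed_points :: "'x topology \<Rightarrow> ('g \<Rightarrow> 'x \<Rightarrow> 'x) \<Rightarrow> 'g set \<Rightarrow> 'x set" where
  "fixed_points X \<phi> H = {x \<in> topspace X. \<forall>\<gamma>\<in>H. \<phi> \<gamma> x = x}"

text \<open>Non-emptiness has to be required separately: the library counts the empty space as
  contractible.\<close>

definition proper_classifying_space ::
  "('g, 'm) monoid_scheme \<Rightarrow> 'x topology \<Rightarrow> ('g \<Rightarrow> 'x \<Rightarrow> 'x) \<Rightarrow> bool" where
  "proper_classifying_space G X \<phi> \<longleftrightarrow>
     G_CW_complex G X \<phi> \<and>
     (\<forall>H. subgroup H G \<longrightarrow>
        (if finite H
         then fixed_points X \<phi> H \<noteq> {} \<and> contractible_space (subtopology X (fixed_points X \<phi> H))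
         else fixed_points X \<phi> H = {}))"

definition invariant_subset :: "('g, 'm) monoid_scheme \<Rightarrow> ('g \<Rightarrow> 'x \<Rightarrow> 'x) \<Rightarrow> 'x set \<Rightarrow> bool" where
  "invariant_subset G \<phi> W \<longleftrightarrow> (\<forall>\<gamma>\<in>carrier G. \<phi> \<gamma> ` W \<subseteq> W)"

text \<open>As usual in the library, the retraction \<open>r\<close> at the end of the homotopy fixes \<open>W\<close>
  pointwise, while the intermediate maps are not required to do so.\<close>

definition equivariant_deformation_retract ::
  "('g, 'm) monoid_scheme \<Rightarrow> 'x topology \<Rightarrow> ('g \<Rightarrow> 'x \<Rightarrow> 'x) \<Rightarrow> 'x set \<Rightarrow> bool" where
  "equivariant_deformation_retract G X \<phi> W \<longleftrightarrow>
     W \<subseteq> topspace X \<and>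
     invariant_subset G \<phi> W \<and>
     (\<exists>r. homotopic_with (\<lambda>f. \<forall>\<gamma>\<in>carrier G. \<forall>x\<in>topspace X. f (\<phi> \<gamma> x) = \<phi> \<gamma> (f x)) X X id r \<and>
          retraction_maps X (subtopology X W) r id)"


section \<open>The symplectic group\<close>

text \<open>The \<open>2g\<close> coordinates are indexed by \<open>'g \<times> bool\<close>, where \<open>g = CARD('g)\<close>: the coordinates
  \<open>(i, False)\<close> and \<open>(i, True)\<close> are, in this order, those of the \<open>i\<close>-th block of \<open>J\<close>.\<close>

type_synonym 'g vec2 = "real ^ ('g \<times> bool)"
type_synonym 'g mat2 = "real ^ ('g \<times> bool) ^ ('g \<times> bool)"

definition symp_J :: "'g::finite mat2" where
  "symp_J = (\<chi> p q. if fst p \<noteq> fst q \<or> snd p = snd q then 0 else if snd q then -1 else 1)"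

definition Sp_real :: "('g::finite mat2) set" where
  "Sp_real = {A. transpose A ** symp_J ** A = symp_J}"

definition Sp_int :: "('g::finite mat2) set" where
  "Sp_int = {A \<in> Sp_real. \<forall>p q. A $ p $ q \<in> \<int>}"

definition unitary :: "('g::finite mat2) set" where
  "unitary = Sp_real \<inter> {A. rotation_matrix A}"

definition Sp_real_group :: "'g::finite mat2 monoid" where
  "Sp_real_group = \<lparr>carrier = Sp_real, mult = (**), one = mat 1\<rparr>"

definition Sp_int_group :: "'g::finite mat2 monoid" where
  "Sp_int_group = Sp_real_group\<lparr>carrier := Sp_int\<rparr>"


section \<open>Siegel space\<close>

abbreviation siegel_class :: "'g::finite mat2 \<Rightarrow> 'g mat2 set" where
  "siegel_class h \<equiv> h <#\<^bsub>Sp_real_group\<^esub> unitary"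

definition siegel_space :: "('g::finite mat2 set) set" where
  "siegel_space = lcosets\<^bsub>Sp_real_group\<^esub> unitary"

text \<open>The quotient topology on \<open>Sp(2g,\<real>)/U(g)\<close>.\<close>

definition siegel_topology :: "('g::finite mat2 set) topology" where
  "siegel_topology = topology (\<lambda>V. V \<subseteq> siegel_space \<and>
     openin (top_of_set Sp_real) {h \<in> Sp_real. siegel_class h \<in> V})"

text \<open>Left translation on cosets. Actions in the sense of \<^locale>\<open>group_action\<close> are by maps that are
  \<open>undefined\<close> outside the space, whence the restriction to \<open>W\<close>.\<close>

definition siegel_action ::
  "('g::finite mat2 set) set \<Rightarrow> 'g mat2 \<Rightarrow> 'g mat2 set \<Rightarrow> 'g mat2 set" where
  "siegel_action W \<gamma> = restrict (\<lambda>x. \<gamma> <#\<^bsub>Sp_real_group\<^esub> x) W"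


section \<open>Systoles\<close>

definition integer_vectors :: "('g::finite vec2) set" where
  "integer_vectors = {v. \<forall>p. v $ p \<in> \<int>}"

definition systoles :: "'g::finite mat2 \<Rightarrow> 'g vec2 set" where
  "systoles A = {v. is_arg_min (\<lambda>v. norm (A *v v)) (\<lambda>v. v \<in> integer_vectors - {0}) v}"

text \<open>The symplectic lattices whose systoles span a space of dimension at least \<open>k\<close>; the coset
  of \<open>h\<close> stands for the lattice with basis matrix \<open>h\<^sup>-\<^sup>1\<close>.\<close>

definition systole_rank_ge :: "nat \<Rightarrow> ('g::finite mat2 set) set" where
  "systole_rank_ge k =
     {siegel_class h | h. h \<in> Sp_real \<and> k \<le> dim (span (systoles (matrix_inv h)))}"


section \<open>Well-definedness\<close>

lemma symp_J_sq: "symp_J ** symp_J = - (mat 1 :: 'g::finite mat2)"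
proof -
  have "(symp_J ** symp_J) $ p $ q = (- (mat 1 :: 'g mat2)) $ p $ q" for p q :: "'g \<times> bool"
  proof -
    obtain i b where p: "p = (i, b)" by (cases p)
    have "(symp_J ** symp_J) $ p $ q = (\<Sum>k\<in>UNIV. symp_J $ p $ k * symp_J $ k $ q)"
      by (simp add: matrix_matrix_mult_def)
    also have "\<dots> = (\<Sum>k\<in>{(i, \<not> b)}. symp_J $ p $ k * symp_J $ k $ q)"
      by (rule sum.mono_neutral_right) (auto simp: symp_J_def p)
    also have "\<dots> = (- (mat 1 :: 'g mat2)) $ p $ q"
      by (cases q; cases b) (auto simp: symp_J_def p mat_def)
    finally show ?thesis .
  qed
  then show ?thesis by (simp add: vec_eq_iff)
qed

lemma Sp_real_left_inverse:
  assumes "A \<in> Sp_real"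
  shows "(- (symp_J ** transpose A ** symp_J)) ** A = mat 1"
proof -
  have "(symp_J ** transpose A ** symp_J) ** A = symp_J ** (transpose A ** symp_J ** A)"
    by (simp add: matrix_mul_assoc)
  also have "\<dots> = - mat 1"
    using assms symp_J_sq by (simp add: Sp_real_def)
  finally show ?thesis
    by (metis add.inverse_inverse matrix_scalar_ac(1) scaleR_minus1_left scalar_matrix_assoc)
qed

lemma Sp_real_matrix_inv:
  assumes "A \<in> Sp_real"
  shows "A ** matrix_inv A = mat 1" "matrix_inv A ** A = mat 1"
    "matrix_inv A = - (symp_J ** transpose A ** symp_J)"
proof -
  have l: "(- (symp_J ** transpose A ** symp_J)) ** A = mat 1"
    by (rule Sp_real_left_inverse[OF assms])
  then have "invertible A"
    using invertible_left_inverse by blast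
  then have "A ** matrix_inv A = mat 1 \<and> matrix_inv A ** A = mat 1"
    unfolding invertible_def matrix_inv_def by (rule someI_ex)
  then show 1: "A ** matrix_inv A = mat 1" "matrix_inv A ** A = mat 1"
    by auto
  show "matrix_inv A = - (symp_J ** transpose A ** symp_J)"
  proof -
    have "matrix_inv A = (- (symp_J ** transpose A ** symp_J)) ** A ** matrix_inv A"
      by (simp only: l matrix_mul_lid)
    also have "\<dots> = - (symp_J ** transpose A ** symp_J)"
      by (simp only: 1(1) matrix_mul_rid flip: matrix_mul_assoc)
    finally show ?thesis .
  qed
qed

lemma Sp_real_mult: "A \<in> Sp_real \<Longrightarrow> B \<in> Sp_real \<Longrightarrow> A ** B \<in> Sp_real"
proof -
  assume A: "A \<in> Sp_real" and B: "B \<in> Sp_real"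
  have "transpose (A ** B) ** symp_J ** (A ** B)
      = transpose B ** (transpose A ** symp_J ** A) ** B"
    by (simp add: matrix_transpose_mul matrix_mul_assoc)
  then show ?thesis using A B by (simp add: Sp_real_def)
qed

lemma Sp_real_one: "mat 1 \<in> Sp_real"
  by (simp add: Sp_real_def transpose_mat)

lemma Sp_real_inv: "A \<in> Sp_real \<Longrightarrow> matrix_inv A \<in> Sp_real"
proof -
  assume A: "A \<in> Sp_real"
  let ?B = "matrix_inv A"
  have "transpose ?B ** symp_J ** ?B = transpose ?B ** (transpose A ** symp_J ** A) ** ?B"
    using A by (simp add: Sp_real_def)
  also have "\<dots> = transpose (A ** ?B) ** symp_J ** (A ** ?B)"
    by (simp add: matrix_transpose_mul matrix_mul_assoc)
  also have "\<dots> = symp_J"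
    by (simp add: Sp_real_matrix_inv(1)[OF A] transpose_mat)
  finally show ?thesis by (simp add: Sp_real_def)
qed

lemma group_Sp_real: "group Sp_real_group"
proof (rule groupI)
  fix A :: "'a mat2" assume "A \<in> carrier Sp_real_group"
  then show "\<exists>B\<in>carrier Sp_real_group. B \<otimes>\<^bsub>Sp_real_group\<^esub> A = \<one>\<^bsub>Sp_real_group\<^esub>"
    using Sp_real_inv Sp_real_matrix_inv(2) by (auto simp: Sp_real_group_def)
qed (auto simp: Sp_real_group_def Sp_real_mult Sp_real_one matrix_mul_assoc)

lemma inv_Sp_real: "A \<in> Sp_real \<Longrightarrow> inv\<^bsub>Sp_real_group\<^esub> A = matrix_inv A"
  by (rule group.inv_equality[OF group_Sp_real])
    (auto simp: Sp_real_group_def Sp_real_inv Sp_real_matrix_inv(2))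

lemma subgroup_unitary: "subgroup unitary Sp_real_group"
proof (rule group.subgroupI[OF group_Sp_real])
  show "unitary \<subseteq> carrier Sp_real_group"
    by (auto simp: unitary_def Sp_real_group_def)
  have "mat 1 \<in> unitary"
    by (simp add: unitary_def Sp_real_one rotation_matrix_def orthogonal_matrix_id)
  then show "unitary \<noteq> {}" by blast
next
  fix A :: "'a mat2" assume A: "A \<in> unitary"
  then have AS: "A \<in> Sp_real" and o: "orthogonal_matrix A" and d: "det A = 1"
    by (auto simp: unitary_def rotation_matrix_def)
  have "transpose A = transpose A ** (A ** matrix_inv A)"
    by (simp add: Sp_real_matrix_inv(1)[OF AS])
  also have "\<dots> = matrix_inv A"
    using o by (simp add: matrix_mul_assoc orthogonal_matrix)
  finally have "matrix_inv A = transpose A" ..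
  then show "inv\<^bsub>Sp_real_group\<^esub> A \<in> unitary"
    using AS o d Sp_real_inv[OF AS]
    by (simp add: inv_Sp_real unitary_def rotation_matrix_def det_transpose)
next
  fix A B :: "'a mat2" assume "A \<in> unitary" "B \<in> unitary"
  then show "A \<otimes>\<^bsub>Sp_real_group\<^esub> B \<in> unitary"
    by (auto simp: unitary_def rotation_matrix_def Sp_real_group_def Sp_real_mult
        orthogonal_matrix_mul det_mul)
qed

lemma subgroup_Sp_int: "subgroup Sp_int Sp_real_group"
proof (rule group.subgroupI[OF group_Sp_real])
  show "Sp_int \<subseteq> carrier Sp_real_group"
    by (auto simp: Sp_int_def Sp_real_group_def)
  have "mat 1 \<in> Sp_int"
    using Sp_real_one by (auto simp: Sp_int_def) (simp add: mat_def)
  then show "Sp_int \<noteq> {}" by blast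
next
  fix A :: "'a mat2" assume A: "A \<in> Sp_int"
  then have AS: "A \<in> Sp_real" and i: "\<And>p q. A $ p $ q \<in> \<int>"
    by (auto simp: Sp_int_def)
  have "matrix_inv A $ p $ q \<in> \<int>" for p q
    unfolding Sp_real_matrix_inv(3)[OF AS]
    by (auto simp: matrix_matrix_mult_def transpose_def symp_J_def i intro!: Ints_sum Ints_mult)
  then show "inv\<^bsub>Sp_real_group\<^esub> A \<in> Sp_int"
    using AS by (simp add: inv_Sp_real Sp_int_def Sp_real_inv)
next
  fix A B :: "'a mat2" assume "A \<in> Sp_int" "B \<in> Sp_int"
  moreover from this have "A ** B \<in> Sp_real"
    by (auto simp: Sp_int_def intro: Sp_real_mult)
  moreover from calculation have "(A ** B) $ p $ q \<in> \<int>" for p q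
    by (auto simp: matrix_matrix_mult_def Sp_int_def simp del: split_paired_All
        intro!: Ints_sum Ints_mult)
  ultimately show "A \<otimes>\<^bsub>Sp_real_group\<^esub> B \<in> Sp_int"
    by (simp add: Sp_int_def Sp_real_group_def)
qed

lemma openin_siegel_topology:
  "openin siegel_topology V \<longleftrightarrow> V \<subseteq> siegel_space \<and>
     openin (top_of_set Sp_real) {h \<in> Sp_real. siegel_class h \<in> V}"
proof -
  have "istopology (\<lambda>V. V \<subseteq> (siegel_space :: 'a mat2 set set) \<and>
     openin (top_of_set Sp_real) {h \<in> Sp_real. siegel_class h \<in> V})"
  proof (unfold istopology_def, intro conjI allI impI)
    fix S T :: "'a mat2 set set"
    assume S: "S \<subseteq> siegel_space \<and> openin (top_of_set Sp_real) {h \<in> Sp_real. siegel_class h \<in> S}"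
      and T: "T \<subseteq> siegel_space \<and> openin (top_of_set Sp_real) {h \<in> Sp_real. siegel_class h \<in> T}"
    have "{h \<in> Sp_real. siegel_class h \<in> S \<inter> T}
        = {h \<in> Sp_real. siegel_class h \<in> S} \<inter> {h \<in> Sp_real. siegel_class h \<in> T}" by auto
    with S T show "openin (top_of_set Sp_real) {h \<in> Sp_real. siegel_class h \<in> S \<inter> T}"
      by (simp only: openin_Int)
    show "S \<inter> T \<subseteq> siegel_space" using S by auto
  next
    fix K :: "'a mat2 set set set"
    assume K: "\<forall>V\<in>K. V \<subseteq> siegel_space \<and>
      openin (top_of_set Sp_real) {h \<in> Sp_real. siegel_class h \<in> V}"
    have "{h \<in> Sp_real. siegel_class h \<in> \<Union>K}
        = \<Union> ((\<lambda>V. {h \<in> Sp_real. siegel_class h \<in> V}) ` K)" by auto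
    moreover have "openin (top_of_set Sp_real)
        (\<Union> ((\<lambda>V. {h \<in> Sp_real. siegel_class h \<in> V}) ` K))"
      by (rule openin_Union) (use K in blast)
    ultimately show "openin (top_of_set Sp_real) {h \<in> Sp_real. siegel_class h \<in> \<Union>K}"
      by (simp only:)
    show "\<Union>K \<subseteq> siegel_space" using K by auto
  qed
  then show ?thesis unfolding siegel_topology_def by (simp add: topology_inverse')
qed

lemma siegel_space_image: "siegel_space = siegel_class ` Sp_real"
  by (auto simp: siegel_space_def LCOSETS_def Sp_real_group_def)

lemma topspace_siegel_topology [simp]:
  "topspace siegel_topology = (siegel_space :: ('g::finite mat2 set) set)" (is "?X = ?S")
proof
  show "?X \<subseteq> ?S"
    using openin_topspace[of "siegel_topology :: ('g mat2 set) topology"] unfolding openin_siegel_topology by (rule conjunct1)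
  have "{h \<in> Sp_real. siegel_class h \<in> siegel_space} = (Sp_real :: 'g mat2 set)"
    by (auto simp: siegel_space_image)
  then have "openin siegel_topology (siegel_space :: ('g mat2 set) set)"
    by (simp add: openin_siegel_topology)
  then show "?S \<subseteq> ?X"
    by (rule openin_subset)
qed

lemma quotient_map_siegel: "quotient_map (top_of_set Sp_real) siegel_topology siegel_class"
  unfolding quotient_map_def openin_siegel_topology topspace_siegel_topology
  by (simp add: siegel_space_image)

lemma siegel_class_translate:
  assumes "\<gamma> \<in> Sp_real" "h \<in> Sp_real"
  shows "\<gamma> <#\<^bsub>Sp_real_group\<^esub> siegel_class h = siegel_class (\<gamma> ** h)"
proof -
  have "unitary \<subseteq> carrier Sp_real_group"
    using subgroup_unitary subgroup.subset by blast
  then show ?thesis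
    using group.lcos_m_assoc[OF group_Sp_real, of unitary \<gamma> h] assms
    by (simp add: Sp_real_group_def)
qed

lemma G_space_siegel:
  "G_space Sp_int_group siegel_topology (siegel_action siegel_space)"
proof -
  have grp: "group (Sp_int_group :: 'a mat2 monoid)"
    unfolding Sp_int_group_def
    by (rule subgroup.subgroup_is_group[OF subgroup_Sp_int group_Sp_real])
  have sub: "A \<in> Sp_real" if "A \<in> carrier Sp_int_group" for A :: "'a mat2"
    using that by (auto simp: Sp_int_group_def Sp_int_def)
  have cls: "siegel_action siegel_space A (siegel_class h) = siegel_class (A ** h)"
    if "A \<in> Sp_real" "h \<in> Sp_real" for A h :: "'a mat2"
    using that by (simp add: siegel_action_def siegel_class_translate siegel_space_image)
  have rep: thesis if "x \<in> siegel_space" "\<And>h. h \<in> Sp_real \<Longrightarrow> x = siegel_class h \<Longrightarrow> thesis"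
    for x :: "'a mat2 set" and thesis
    using that by (auto simp: siegel_space_image)
  have act: "siegel_action siegel_space A x \<in> siegel_space"
    if "A \<in> Sp_real" "x \<in> siegel_space" for A :: "'a mat2" and x
    using that(2) by (rule rep) (simp add: cls that(1), simp add: siegel_space_image Sp_real_mult that(1))
  have bij: "siegel_action siegel_space A \<in> Bij siegel_space" if A: "A \<in> Sp_real" for A :: "'a mat2"
  proof -
    have *: "A ** (matrix_inv A ** h) = h" "matrix_inv A ** (A ** h) = h" for h :: "'a mat2"
      by (simp_all add: matrix_mul_assoc Sp_real_matrix_inv(1,2)[OF A])
    note A' = Sp_real_inv[OF A]
    have "bij_betw (siegel_action siegel_space A) siegel_space siegel_space"
    proof (rule bij_betw_byWitness[where f' = "siegel_action siegel_space (matrix_inv A)"])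
      show "\<forall>x\<in>siegel_space.
          siegel_action siegel_space (matrix_inv A) (siegel_action siegel_space A x) = x"
        using cls[OF A] cls[OF A'] Sp_real_mult[OF A] *(2) by (auto elim!: rep)
      show "\<forall>x\<in>siegel_space.
          siegel_action siegel_space A (siegel_action siegel_space (matrix_inv A) x) = x"
        using cls[OF A] cls[OF A'] Sp_real_mult[OF A'] *(1) by (auto elim!: rep)
    qed (use A A' in \<open>auto intro: act\<close>)
    then show ?thesis by (simp add: Bij_def siegel_action_def)
  qed
  have hom: "siegel_action siegel_space (A ** B)
      = compose siegel_space (siegel_action siegel_space A) (siegel_action siegel_space B)"
    if AB: "A \<in> Sp_real" "B \<in> Sp_real" for A B :: "'a mat2"
  proof (rule extensionalityI[of _ siegel_space])
    show "siegel_action siegel_space (A ** B) x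
      = compose siegel_space (siegel_action siegel_space A) (siegel_action siegel_space B) x"
      if "x \<in> siegel_space" for x
      using that
    proof (rule rep)
      fix h assume h: "h \<in> Sp_real" "x = siegel_class h"
      show ?thesis
        unfolding compose_eq[OF that]
        unfolding h(2) cls[OF AB(2) h(1)] cls[OF AB(1) Sp_real_mult[OF AB(2) h(1)]]
          cls[OF Sp_real_mult[OF AB] h(1)]
        by (simp add: matrix_mul_assoc)
    qed
  qed (simp_all only: siegel_action_def restrict_extensional compose_extensional)
  have "group_action Sp_int_group siegel_space (siegel_action (siegel_space :: 'a mat2 set set))"
  proof (intro group_action.intro group_hom.intro group_hom_axioms.intro homI grp group_BijGroup)
    fix A B :: "'a mat2" assume A: "A \<in> carrier Sp_int_group" and B: "B \<in> carrier Sp_int_group"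
    show "siegel_action siegel_space A \<in> carrier (BijGroup siegel_space)"
      using bij[OF sub[OF A]] by (simp add: BijGroup_def)
    have "A \<otimes>\<^bsub>Sp_int_group\<^esub> B = A ** B"
      by (simp add: Sp_int_group_def Sp_real_group_def)
    then show "siegel_action siegel_space (A \<otimes>\<^bsub>Sp_int_group\<^esub> B)
      = siegel_action siegel_space A \<otimes>\<^bsub>BijGroup siegel_space\<^esub> siegel_action siegel_space B"
      using bij[OF sub[OF A]] bij[OF sub[OF B]] hom[OF sub[OF A] sub[OF B]]
      by (simp add: BijGroup_def)
  qed
  moreover have "continuous_map siegel_topology siegel_topology (siegel_action siegel_space A)"
    if A: "A \<in> Sp_real" for A :: "'a mat2"
  proof -
    have "continuous_map (top_of_set Sp_real) (top_of_set Sp_real) ((**) A)"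
    proof -
      have "continuous_on Sp_real ((**) A)"
        unfolding matrix_matrix_mult_def by (intro continuous_intros)
      moreover have "(**) A \<in> Sp_real \<rightarrow> Sp_real"
        using A by (simp add: Sp_real_mult)
      ultimately show ?thesis by simp
    qed
    then have "continuous_map (top_of_set Sp_real) siegel_topology (siegel_class \<circ> (**) A)"
      by (rule continuous_map_compose[OF _ quotient_imp_continuous_map[OF quotient_map_siegel]])
    then have "continuous_map (top_of_set Sp_real) siegel_topology
        (siegel_action siegel_space A \<circ> siegel_class)"
      by (rule continuous_map_eq) (simp add: cls A)
    then show ?thesis
      by (rule continuous_compose_quotient_map[OF quotient_map_siegel])
  qed
  ultimately show ?thesis
    unfolding G_space_def topspace_siegel_topology using sub by blast
qed

text \<open>The rank of the systoles does not depend on the representative of the coset.\<close>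

lemma systoles_siegel_class:
  assumes "h \<in> Sp_real" "h' \<in> Sp_real" "siegel_class h = siegel_class h'"
  shows "systoles (matrix_inv h) = systoles (matrix_inv h')"
proof -
  have "h' \<in> siegel_class h"
    using group.lcos_self[OF group_Sp_real _ subgroup_unitary, of h'] assms
    by (simp add: Sp_real_group_def)
  then obtain u where u: "u \<in> unitary" "h' = h ** u"
    by (auto simp: l_coset_def Sp_real_group_def)
  have uS: "u \<in> Sp_real" and o: "orthogonal_matrix (matrix_inv u)"
    using u(1) subgroup.m_inv_closed[OF subgroup_unitary u(1)]
    by (auto simp: unitary_def rotation_matrix_def inv_Sp_real)
  have h': "matrix_inv h' = matrix_inv u ** matrix_inv h"
  proof -
    have "h' ** (matrix_inv u ** matrix_inv h) = h ** (u ** matrix_inv u) ** matrix_inv h"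
      by (simp only: u(2) matrix_mul_assoc)
    also have "\<dots> = mat 1"
      by (simp only: Sp_real_matrix_inv(1) uS assms(1) matrix_mul_rid)
    finally have "h' ** (matrix_inv u ** matrix_inv h) = mat 1" .
    then have "matrix_inv h' ** h' ** (matrix_inv u ** matrix_inv h) = matrix_inv h'"
      by (simp only: matrix_mul_rid flip: matrix_mul_assoc)
    then show ?thesis
      by (simp only: Sp_real_matrix_inv(2)[OF assms(2)] matrix_mul_lid)
  qed
  have "orthogonal_transformation ((*v) (matrix_inv u))"
    using o by (simp add: orthogonal_transformation_matrix)
  then have "norm (matrix_inv h' *v v) = norm (matrix_inv h *v v)" for v
    unfolding h' by (simp add: orthogonal_transformation_norm flip: matrix_vector_mul_assoc)
  then show ?thesis by (simp add: systoles_def)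
qed

lemma siegel_class_mem_systole_rank_ge:
  assumes "h \<in> Sp_real"
  shows "siegel_class h \<in> systole_rank_ge k \<longleftrightarrow> k \<le> dim (span (systoles (matrix_inv h)))"
proof
  assume "siegel_class h \<in> systole_rank_ge k"
  then obtain h' where h': "siegel_class h = siegel_class h'" "h' \<in> Sp_real"
    "k \<le> dim (span (systoles (matrix_inv h')))"
    unfolding systole_rank_ge_def by blast
  show "k \<le> dim (span (systoles (matrix_inv h)))"
    using h'(3) unfolding systoles_siegel_class[OF assms h'(2) h'(1)] .
next
  assume "k \<le> dim (span (systoles (matrix_inv h)))"
  with assms show "siegel_class h \<in> systole_rank_ge k"
    unfolding systole_rank_ge_def by blast
qed

end

theory Submission
  imports Defs "HOL-Algebra.Multiplicative_Group"
begin

text \<open>The symplectic lattice \<open>\<Lambda> = \<int>[\<i>] \<oplus> \<int>[\<omega>]\<^sup>g\<^sup>-\<^sup>1\<close>, each summand scaled to covolume 1, is the unique fixed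
  point in Siegel space of an element of order 12 of \<open>Sp(2g,\<int>)\<close>, which multiplies the summands by
  roots of unity of orders 4 and 6. The nonzero vectors of \<open>\<int>[\<i>]\<close> have squared length at least 1,
  those of \<open>\<int>[\<omega>]\<close> at least \<open>2/\<surd>3 > 1\<close>, so the systoles of \<open>\<Lambda>\<close> lie in the plane of the first
  summand. Hence the finite group generated by this element has no fixed point among the lattices
  of systole rank at least 3, whereas it has one in every model for the proper classifying space
  and, by equivariance of the retraction, in every equivariant deformation retract.\<close>

section \<open>Matrices made of 2x2 blocks\<close>

text \<open>The entries are functions of the position because the block at one position
  \<open>k\<close> will differ from the others. The block at \<open>i\<close> has rows
  \<open>(a i, b i)\<close> and \<open>(c i, d i)\<close>, so products and transposes are computed
  blockwise.\<close>

definition block_diag :: "('g \<Rightarrow> real) \<Rightarrow> ('g \<Rightarrow> real) \<Rightarrow> ('g \<Rightarrow> real) \<Rightarrow> ('g \<Rightarrow> real) \<Rightarrow> 'g::finite mat2" where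
  "block_diag a b c d = (\<chi> p q. if fst p \<noteq> fst q then 0
     else (if snd p then (if snd q then d else c) else (if snd q then b else a)) (fst p))"

lemma sum_prod_bool:
  fixes f :: "'g::finite \<times> bool \<Rightarrow> 'a::comm_monoid_add"
  shows "(\<Sum>p\<in>UNIV. f p) = (\<Sum>i\<in>UNIV. f (i, False) + f (i, True))"
  by (simp add: UNIV_bool sum.cartesian_product' flip: UNIV_Times_UNIV)

lemma block_diag_vector:
  "(block_diag a b c d *v v) $ (i, False) = a i * v $ (i, False) + b i * v $ (i, True)"
  "(block_diag a b c d *v v) $ (i, True) = c i * v $ (i, False) + d i * v $ (i, True)"
proof -
  have *: "(if i \<noteq> j then 0 else x) * y + (if i \<noteq> j then 0 else x') * y' = (if i = j then x * y + x' * y' else 0)"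
    for j and x y x' y' :: real by simp
  show "(block_diag a b c d *v v) $ (i, False) = a i * v $ (i, False) + b i * v $ (i, True)"
   "(block_diag a b c d *v v) $ (i, True) = c i * v $ (i, False) + d i * v $ (i, True)"
    by (simp_all add: block_diag_def matrix_vector_mult_def sum_prod_bool * del: mult_eq_0_iff cong: if_cong)
qed

lemma block_diag_mult:
  "block_diag a b c d ** block_diag a' b' c' d' =
     block_diag (\<lambda>i. a i * a' i + b i * c' i) (\<lambda>i. a i * b' i + b i * d' i)
       (\<lambda>i. c i * a' i + d i * c' i) (\<lambda>i. c i * b' i + d i * d' i)"
proof (unfold matrix_eq vec_eq_iff, clarify)
  fix x :: "'a vec2"
  show "(block_diag a b c d ** block_diag a' b' c' d' *v x) $ (i, r) =
      (block_diag (\<lambda>i. a i * a' i + b i * c' i) (\<lambda>i. a i * b' i + b i * d' i)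
       (\<lambda>i. c i * a' i + d i * c' i) (\<lambda>i. c i * b' i + d i * d' i) *v x) $ (i, r)" for i r
    by (cases r) (simp_all add: block_diag_vector algebra_simps flip: matrix_vector_mul_assoc)
qed

lemma block_diag_add:
  "block_diag a b c d + block_diag a' b' c' d' =
     block_diag (\<lambda>i. a i + a' i) (\<lambda>i. b i + b' i) (\<lambda>i. c i + c' i) (\<lambda>i. d i + d' i)"
  by (simp add: block_diag_def vec_eq_iff)

lemma block_diag_scaleR:
  "r *\<^sub>R block_diag a b c d = block_diag (\<lambda>i. r * a i) (\<lambda>i. r * b i) (\<lambda>i. r * c i) (\<lambda>i. r * d i)"
  by (simp add: block_diag_def vec_eq_iff)

lemma matrix_mul_minus_left: "(- A) ** B = - (A ** B)" for A :: "real^'n^'m"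
  by (simp add: matrix_matrix_mult_def vec_eq_iff sum_negf)

lemma matrix_mul_minus_right: "A ** (- B) = - (A ** B)" for A :: "real^'n^'m"
  by (simp add: matrix_matrix_mult_def vec_eq_iff sum_negf)

lemma matrix_add_rdistrib: "(A + B) ** C = A ** C + B ** C"
  by (simp add: matrix_matrix_mult_def vec_eq_iff sum.distrib distrib_right)

lemma block_diag_cong:
  "(\<And>i. a i = a' i \<and> b i = b' i \<and> c i = c' i \<and> d i = d' i) \<Longrightarrow> block_diag a b c d = block_diag a' b' c' d'"
  by presburger

lemma symp_J_block: "symp_J = block_diag (\<lambda>i. 0) (\<lambda>i. -1) (\<lambda>i. 1) (\<lambda>i. 0)"
  by (auto simp: symp_J_def block_diag_def vec_eq_iff)

lemma mat_1_block: "mat 1 = block_diag (\<lambda>i. 1) (\<lambda>i. 0) (\<lambda>i. 0) (\<lambda>i. 1)"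
  by (auto simp: mat_def block_diag_def vec_eq_iff)

lemma transpose_block_diag: "transpose (block_diag a b c d) = block_diag a c b d"
  by (auto simp: transpose_def block_diag_def vec_eq_iff)

lemma block_diag_in_Sp_real:
  assumes "\<And>i. a i * d i - b i * c i = 1"
  shows "block_diag a b c d \<in> Sp_real"
  unfolding Sp_real_def symp_J_block mem_Collect_eq transpose_block_diag block_diag_mult
  by (rule block_diag_cong) (use assms in \<open>simp add: algebra_simps\<close>)

lemma block_diag_quadratic_form:
  "v \<bullet> (block_diag a b c d *v v) =
     (\<Sum>i\<in>UNIV. a i * (v $ (i, False))\<^sup>2 + (b i + c i) * (v $ (i, False) * v $ (i, True)) + d i * (v $ (i, True))\<^sup>2)"
  by (auto simp: inner_vec_def sum_prod_bool block_diag_vector algebra_simps power2_eq_square intro!: sum.cong)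

text \<open>The rotations are clockwise, the sense in which the blocks of \<open>elliptic\<close>
  turn.\<close>

definition rotations :: "('g \<Rightarrow> real) \<Rightarrow> 'g::finite mat2" where
  "rotations t = block_diag (\<lambda>i. cos (t i)) (\<lambda>i. sin (t i)) (\<lambda>i. - sin (t i)) (\<lambda>i. cos (t i))"

lemma rotations_unitary: "rotations t \<in> unitary"
proof -
  have o: "orthogonal_matrix (rotations t)" for t :: "'a \<Rightarrow> real"
    unfolding orthogonal_matrix rotations_def transpose_block_diag block_diag_mult mat_1_block
    by (rule block_diag_cong) (simp flip: power2_eq_square)
  \<comment> \<open>Orthogonality only gives determinant 1 or -1; as the square of the half-angle
    rotation, the matrix has determinant 1.\<close>
  have "rotations t = rotations (\<lambda>i. t i / 2) ** rotations (\<lambda>i. t i / 2)"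
    unfolding rotations_def block_diag_mult
    by (rule block_diag_cong)
      (use cos_double[of "t i / 2" for i] sin_double[of "t i / 2" for i] in \<open>simp add: power2_eq_square\<close>)
  then have "det (rotations t) = det (rotations (\<lambda>i. t i / 2)) * det (rotations (\<lambda>i. t i / 2))"
    by (simp add: det_mul)
  then have "det (rotations t) = 1"
    using det_orthogonal_matrix[OF o, of "\<lambda>i. t i / 2"] by auto
  moreover have "rotations t \<in> Sp_real"
    unfolding rotations_def by (rule block_diag_in_Sp_real) (simp flip: power2_eq_square)
  ultimately show ?thesis
    using o by (simp add: unitary_def rotation_matrix_def)
qed

section \<open>Compatible complex structures\<close>

text \<open>The transpose of an orthogonal matrix is its inverse, which turns the symplectic
  relation into commutation.\<close>

lemma unitary_symp_J_commute:
  assumes "u \<in> unitary"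
  shows "u ** symp_J = symp_J ** u"
proof -
  have "transpose u ** symp_J ** u = symp_J" "u ** transpose u = mat 1"
    using assms by (auto simp: unitary_def Sp_real_def rotation_matrix_def orthogonal_matrix_def)
  then show ?thesis
    by (metis matrix_mul_assoc matrix_mul_lid)
qed


text \<open>If \<open>P\<close> and \<open>K\<close> commute, \<open>P\<close> acts as \<open>-K\<close> on the image of \<open>P - K\<close>, which positivity
  then forces to be zero.\<close>

lemma commuting_compatible_complex_structures_eq:
  fixes P K :: "'g::finite mat2"
  assumes "P ** P = - mat 1" "K ** K = - mat 1" "P ** K = K ** P"
    and P: "\<And>v. 0 \<le> v \<bullet> (symp_J ** P *v v)"
    and K: "\<And>v. v \<noteq> 0 \<Longrightarrow> 0 < v \<bullet> (symp_J ** K *v v)"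
  shows "P = K"
proof -
  have "P *v v = K *v v" for v
  proof -
    define z where "z = P *v v - K *v v"
    have "P *v z = - (K *v z)"
      using assms(1-3) by (simp add: z_def matrix_vector_mult_diff_distrib matrix_vector_mul_assoc)
    then have "z \<bullet> (symp_J ** P *v z) = - (z \<bullet> (symp_J ** K *v z))"
      by (simp add: vec.neg flip: matrix_vector_mul_assoc)
    with P[of z] K[of z] have "z = 0" by force
    then show ?thesis by (simp add: z_def)
  qed
  then show ?thesis by (simp add: matrix_eq)
qed

text \<open>Encodes the lattice metric in a complex structure on integer coordinates:
  \<open>symp_J\<close> times \<open>- (h ** symp_J ** matrix_inv h)\<close> is the Gram matrix of
  the basis \<open>matrix_inv h\<close>. The sign compensates
  \<open>symp_J ** symp_J = - mat 1\<close>.\<close>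

lemma norm_matrix_inv_Sp_real:
  assumes "h \<in> Sp_real"
  shows "v \<bullet> (symp_J ** - (h ** symp_J ** matrix_inv h) *v v) = (norm (matrix_inv h *v v))\<^sup>2"
proof -
  have "symp_J ** h = transpose (matrix_inv h) ** symp_J"
  proof -
    have "transpose (matrix_inv h) ** (transpose h ** symp_J ** h) = symp_J ** h"
      using Sp_real_matrix_inv(1)[OF assms]
      by (simp add: matrix_mul_assoc flip: matrix_transpose_mul)
    with assms show ?thesis by (simp add: Sp_real_def)
  qed
  then have "symp_J ** (h ** symp_J ** matrix_inv h) = transpose (matrix_inv h) ** (symp_J ** symp_J) ** matrix_inv h"
    by (simp add: matrix_mul_assoc)
  then have "symp_J ** - (h ** symp_J ** matrix_inv h) = transpose (matrix_inv h) ** matrix_inv h"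
    by (simp add: symp_J_sq matrix_mul_minus_left matrix_mul_minus_right)
  then show ?thesis
    by (simp add: power2_norm_eq_inner inner_commute[of v] dot_lmul_matrix flip: matrix_vector_mul_assoc)
qed

section \<open>The elliptic element and its complex structure\<close>

text \<open>The automorphism of \<open>\<int>[\<i>] \<oplus> \<int>[\<omega>]\<^sup>g\<^sup>-\<^sup>1\<close> (with the Gaussian summand in position \<open>k\<close>) that acts
  on the summands by a fourth and by sixth roots of unity.\<close>

definition elliptic :: "'g \<Rightarrow> 'g::finite mat2" where
  "elliptic k = block_diag (\<lambda>i. if i = k then 0 else 1) (\<lambda>i. 1) (\<lambda>i. -1) (\<lambda>i. 0)"

text \<open>The complex structure of the same lattice, in these coordinates.\<close>

definition elliptic_structure :: "'g \<Rightarrow> 'g::finite mat2" where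
  "elliptic_structure k = block_diag
     (\<lambda>i. if i = k then 0 else 1 / sqrt 3) (\<lambda>i. if i = k then 1 else 2 / sqrt 3)
     (\<lambda>i. if i = k then -1 else - 2 / sqrt 3) (\<lambda>i. if i = k then 0 else - 1 / sqrt 3)"

lemma elliptic_Sp_int: "elliptic k \<in> Sp_int"
proof -
  have "elliptic k \<in> Sp_real"
    unfolding elliptic_def by (rule block_diag_in_Sp_real) simp
  then show ?thesis
    by (simp add: Sp_int_def elliptic_def block_diag_def)
qed

text \<open>Finite order makes the subgroup generated by \<open>elliptic k\<close> finite, as needed
  to obtain a fixed point in a model.\<close>

lemma elliptic_power_12:
  "elliptic k [^]\<^bsub>Sp_int_group\<^esub> (12::nat) = \<one>\<^bsub>Sp_int_group\<^esub>"
proof -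
  \<comment> \<open>Cubing turns the blocks of order 6 into -1 and leaves a block of order 4 at
    \<open>k\<close>, so the fourth power of the cube is the identity.\<close>
  have 3: "elliptic k ** elliptic k ** elliptic k
      = block_diag (\<lambda>i. if i = k then 0 else -1) (\<lambda>i. if i = k then -1 else 0)
          (\<lambda>i. if i = k then 1 else 0) (\<lambda>i. if i = k then 0 else -1)"
    (is "_ = ?c")
    unfolding elliptic_def block_diag_mult by (rule block_diag_cong) simp
  have 4: "?c ** ?c ** ?c ** ?c = mat 1"
    unfolding block_diag_mult mat_1_block by (rule block_diag_cong) simp
  show ?thesis
    using 4 by (simp add: eval_nat_numeral Sp_int_group_def Sp_real_group_def matrix_mul_assoc flip: 3)
qed

text \<open>The cubic \<open>p(x) = (s - 1) + (1 + s)x + (s - 1)x\<^sup>2 + sx\<^sup>3\<close> with \<open>s = 1/\<surd>3\<close> takes the value \<open>\<i>\<close>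
  both at \<open>\<i>\<close> and at \<open>e\<^sup>i\<^sup>\<pi>\<^sup>/\<^sup>3\<close>.\<close>

lemma elliptic_structure_polynomial:
  fixes k :: "'g::finite"
  defines "s \<equiv> 1 / sqrt 3" and "E \<equiv> elliptic k"
  shows "elliptic_structure k
    = (s - 1) *\<^sub>R mat 1 + (1 + s) *\<^sub>R E + (s - 1) *\<^sub>R (E ** E) + s *\<^sub>R (E ** E ** E)"
  unfolding E_def elliptic_def mat_1_block block_diag_mult block_diag_scaleR block_diag_add
    elliptic_structure_def s_def
  by (rule block_diag_cong) (simp add: field_simps)

text \<open>The structure is a polynomial in \<open>elliptic k\<close>, so it commutes with whatever
  \<open>elliptic k\<close> commutes with.\<close>

lemma commute_elliptic_structure:
  assumes "P ** elliptic k = elliptic k ** P"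
  shows "P ** elliptic_structure k = elliptic_structure k ** P"
proof -
  let ?E = "elliptic k"
  have mult: "P ** (A ** B) = A ** B ** P" if "P ** A = A ** P" "P ** B = B ** P" for A B
  proof -
    have "P ** (A ** B) = A ** (P ** B)"
      by (simp only: that(1) matrix_mul_assoc)
    then show ?thesis
      by (simp only: that(2) matrix_mul_assoc)
  qed
  note 2 = mult[OF assms assms]
  note 3 = mult[OF 2 assms]
  show ?thesis
    unfolding elliptic_structure_polynomial
    by (simp only: matrix_add_ldistrib matrix_add_rdistrib matrix_scalar_ac scalar_matrix_assoc[symmetric]
        assms 2 3 matrix_mul_lid matrix_mul_rid)
qed

lemma elliptic_structure_sq: "elliptic_structure k ** elliptic_structure k = - mat 1"
proof -
  have "- mat 1 = (block_diag (\<lambda>i. -1) (\<lambda>i. 0) (\<lambda>i. 0) (\<lambda>i. -1) :: 'a mat2)"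
    by (auto simp: mat_def block_diag_def vec_eq_iff)
  then show ?thesis
    unfolding elliptic_structure_def block_diag_mult
    by (simp only:) (rule block_diag_cong, simp add: field_simps)
qed

text \<open>Position \<open>k\<close> carries the norm form of the Gaussian integers, every other
  position that of the Eisenstein integers; the factor \<open>2 / sqrt 3\<close> normalizes the Gram
  determinant of the latter to 1.\<close>

lemma elliptic_structure_form:
  "v \<bullet> (symp_J ** elliptic_structure k *v v) =
     (v $ (k, False))\<^sup>2 + (v $ (k, True))\<^sup>2 +
     2 / sqrt 3 * (\<Sum>i\<in>-{k}. (v $ (i, False))\<^sup>2 + v $ (i, False) * v $ (i, True) + (v $ (i, True))\<^sup>2)"
proof -
  have "v \<bullet> (symp_J ** elliptic_structure k *v v) =
    (\<Sum>i\<in>UNIV. if i = k then (v $ (k, False))\<^sup>2 + (v $ (k, True))\<^sup>2 else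
      2 / sqrt 3 * ((v $ (i, False))\<^sup>2 + v $ (i, False) * v $ (i, True) + (v $ (i, True))\<^sup>2))"
    unfolding symp_J_block elliptic_structure_def block_diag_mult block_diag_quadratic_form
    by (rule sum.cong) (auto simp: divide_inverse algebra_simps)
  also have "\<dots> = (v $ (k, False))\<^sup>2 + (v $ (k, True))\<^sup>2 +
    (\<Sum>i\<in>-{k}. if i = k then (v $ (k, False))\<^sup>2 + (v $ (k, True))\<^sup>2 else
      2 / sqrt 3 * ((v $ (i, False))\<^sup>2 + v $ (i, False) * v $ (i, True) + (v $ (i, True))\<^sup>2))"
    by (subst sum.remove[of _ k]) (auto simp: Compl_eq_Diff_UNIV)
  finally show ?thesis by (simp add: sum_distrib_left)
qed

lemma sum_squares_add_mult_pos:
  fixes x y :: real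
  shows "0 \<le> x\<^sup>2 + x * y + y\<^sup>2" and "x \<noteq> 0 \<or> y \<noteq> 0 \<Longrightarrow> 0 < x\<^sup>2 + x * y + y\<^sup>2"
proof -
  have *: "x\<^sup>2 + x * y + y\<^sup>2 = (x + y / 2)\<^sup>2 + 3 / 4 * y\<^sup>2"
    by (simp add: power2_eq_square algebra_simps)
  show "0 \<le> x\<^sup>2 + x * y + y\<^sup>2" unfolding * by simp
  show "0 < x\<^sup>2 + x * y + y\<^sup>2" if "x \<noteq> 0 \<or> y \<noteq> 0"
    using that unfolding * by (cases "y = 0") (auto intro: add_nonneg_pos)
qed

lemma elliptic_structure_positive:
  assumes "v \<noteq> 0"
  shows "0 < v \<bullet> (symp_J ** elliptic_structure k *v v)"
proof -
  let ?q = "\<lambda>i. (v $ (i, False))\<^sup>2 + v $ (i, False) * v $ (i, True) + (v $ (i, True))\<^sup>2"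
  obtain i b where i: "v $ (i, b) \<noteq> 0"
    using assms by (auto simp: vec_eq_iff)
  have nonneg: "0 \<le> (\<Sum>i\<in>-{k}. ?q i)"
    by (intro sum_nonneg sum_squares_add_mult_pos(1))
  show ?thesis
  proof (cases "i = k")
    case True
    with i have "0 < (v $ (k, False))\<^sup>2 + (v $ (k, True))\<^sup>2"
      by (cases b) (auto simp: sum_power2_gt_zero_iff)
    then show ?thesis
      unfolding elliptic_structure_form using nonneg by (auto intro: add_pos_nonneg)
  next
    case False
    have "0 < ?q i"
      using i by (intro sum_squares_add_mult_pos(2)) (cases b; simp)
    with False have "0 < (\<Sum>i\<in>-{k}. ?q i)"
      by (intro sum_pos2[of _ i] sum_squares_add_mult_pos(1)) auto
    then show ?thesis
      unfolding elliptic_structure_form by (intro add_nonneg_pos) auto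
  qed
qed

section \<open>Lattices fixed by the elliptic element\<close>

text \<open>The assumption \<open>conj\<close> says that the coset of \<open>h\<close> is fixed. As
  \<open>u\<close> commutes with \<open>symp_J\<close>, the complex structure \<open>P\<close> of
  the lattice commutes with \<open>elliptic k\<close>, hence with
  \<open>elliptic_structure k\<close>; by uniqueness the two agree, which determines the
  metric.\<close>

lemma norm_matrix_inv_elliptic_fixed:
  assumes h: "h \<in> Sp_real" and u: "u \<in> unitary" and conj: "elliptic k ** h = h ** u"
  shows "(norm (matrix_inv h *v v))\<^sup>2 = v \<bullet> (symp_J ** elliptic_structure k *v v)"
proof -
  define P where "P = - (h ** symp_J ** matrix_inv h)"
  note inv = Sp_real_matrix_inv(1,2)[OF h]
  have "P ** P = h ** symp_J ** (matrix_inv h ** h) ** symp_J ** matrix_inv h"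
    by (simp add: P_def matrix_mul_minus_left matrix_mul_minus_right matrix_mul_assoc)
  also have "\<dots> = h ** (symp_J ** symp_J) ** matrix_inv h"
    by (simp only: inv matrix_mul_rid matrix_mul_assoc)
  also have "\<dots> = - mat 1"
    by (simp add: symp_J_sq matrix_mul_minus_left matrix_mul_minus_right inv)
  finally have PP: "P ** P = - mat 1" .
  have ui: "matrix_inv h ** elliptic k = u ** matrix_inv h"
  proof -
    have "matrix_inv h ** elliptic k = matrix_inv h ** (elliptic k ** h) ** matrix_inv h"
      by (simp add: inv flip: matrix_mul_assoc)
    also have "\<dots> = (matrix_inv h ** h) ** u ** matrix_inv h"
      by (simp only: conj matrix_mul_assoc)
    finally show ?thesis by (simp add: inv)
  qed
  have "h ** symp_J ** matrix_inv h ** elliptic k = h ** symp_J ** (u ** matrix_inv h)"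
    by (simp only: ui flip: matrix_mul_assoc)
  also have "\<dots> = h ** (symp_J ** u) ** matrix_inv h"
    by (simp only: matrix_mul_assoc)
  also have "\<dots> = (h ** u) ** symp_J ** matrix_inv h"
    by (simp only: unitary_symp_J_commute[OF u, symmetric] matrix_mul_assoc)
  also have "\<dots> = elliptic k ** (h ** symp_J ** matrix_inv h)"
    by (simp only: conj[symmetric] matrix_mul_assoc)
  finally have "P ** elliptic k = elliptic k ** P"
    by (simp add: P_def matrix_mul_minus_left matrix_mul_minus_right)
  then have commute: "P ** elliptic_structure k = elliptic_structure k ** P"
    by (rule commute_elliptic_structure)
  have form: "v \<bullet> (symp_J ** P *v v) = (norm (matrix_inv h *v v))\<^sup>2" for v
    unfolding P_def by (rule norm_matrix_inv_Sp_real[OF h])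
  \<comment> \<open>Positivity holds on both sides: the form of \<open>P\<close> is a squared norm,
    and that of \<open>elliptic_structure k\<close> is positive definite.\<close>
  have "P = elliptic_structure k"
    using PP elliptic_structure_sq commute
    by (rule commuting_compatible_complex_structures_eq)
      (simp_all only: form zero_le_power2 elliptic_structure_positive not_False_eq_True)
  with form[of v] show ?thesis
    by simp
qed

lemma systoles_elliptic_fixed:
  assumes "h \<in> Sp_real" "u \<in> unitary" "elliptic k ** h = h ** u"
  shows "systoles (matrix_inv h) \<subseteq> span {axis (k, False) 1, axis (k, True) 1}"
proof
  fix v assume v: "v \<in> systoles (matrix_inv h)"
  note form = norm_matrix_inv_elliptic_fixed[OF assms, unfolded elliptic_structure_form]
  let ?q = "\<lambda>v i. (v $ (i, False))\<^sup>2 + v $ (i, False) * v $ (i, True) + (v $ (i, True))\<^sup>2"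
  \<comment> \<open>A competitor of length 1 in the Gaussian plane, which bounds the length of every
    systole.\<close>
  let ?e = "axis (k, False) 1 :: 'a vec2"
  have "?e \<in> integer_vectors - {0}"
    by (auto simp: integer_vectors_def axis_def vec_eq_iff)
  with v have "norm (matrix_inv h *v v) \<le> norm (matrix_inv h *v ?e)"
    by (auto simp: systoles_def is_arg_min_linorder)
  then have "(norm (matrix_inv h *v v))\<^sup>2 \<le> (norm (matrix_inv h *v ?e))\<^sup>2"
    by (rule power_mono) simp
  also have "\<dots> = 1"
    unfolding form by (subst sum.neutral) (auto simp: axis_def)
  finally have le: "(norm (matrix_inv h *v v))\<^sup>2 \<le> 1" .
  have int: "v $ p \<in> \<int>" for p
    using v by (cases p) (simp add: systoles_def is_arg_min_linorder integer_vectors_def)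
  have zero: "v $ (i, b) = 0" if "i \<noteq> k" for i b
  proof (rule ccontr)
    assume "v $ (i, b) \<noteq> 0"
    then have "0 < ?q v i"
      by (intro sum_squares_add_mult_pos(2)) (cases b; simp)
    moreover have "?q v i \<in> \<int>"
      by (intro Ints_add Ints_mult Ints_power int)
    ultimately have "1 \<le> ?q v i"
      by (auto elim!: Ints_cases)
    also have "\<dots> \<le> (\<Sum>i\<in>-{k}. ?q v i)"
      using that by (intro member_le_sum sum_squares_add_mult_pos(1)) auto
    finally have "2 / sqrt 3 * 1 \<le> 2 / sqrt 3 * (\<Sum>i\<in>-{k}. ?q v i)"
      by (intro mult_left_mono) auto
    also have "\<dots> \<le> 1"
      using le unfolding form by (smt (verit) zero_le_power2)
    finally have "sqrt 4 \<le> sqrt 3"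
      by (simp add: field_simps)
    then show False
      by (simp only: real_sqrt_le_iff)
  qed
  have "v = v $ (k, False) *\<^sub>R axis (k, False) 1 + v $ (k, True) *\<^sub>R axis (k, True) 1"
  proof (unfold vec_eq_iff, clarify)
    show "v $ (i, b) = (v $ (k, False) *\<^sub>R axis (k, False) 1 + v $ (k, True) *\<^sub>R axis (k, True) 1) $ (i, b)" for i b
      by (cases b; cases "i = k") (auto simp: axis_def zero)
  qed
  also have "\<dots> \<in> span {axis (k, False) 1, axis (k, True) 1}"
    by (intro span_add span_scale span_base) auto
  finally show "v \<in> span {axis (k, False) 1, axis (k, True) 1}" .
qed

text \<open>Keeping \<open>W\<close> arbitrary covers both the action restricted to a model and the
  action on the whole Siegel space.\<close>

lemma elliptic_fixed_not_systole_rank_ge_3: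
  assumes x: "x \<in> siegel_space" and fixed: "siegel_action W (elliptic k) x = x" and W: "x \<in> W"
  shows "x \<notin> systole_rank_ge 3"
proof -
  obtain h where h: "h \<in> Sp_real" "x = siegel_class h"
    using x by (auto simp: siegel_space_image)
  have E: "elliptic k \<in> Sp_real"
    using elliptic_Sp_int by (auto simp: Sp_int_def)
  have "siegel_class (elliptic k ** h) = siegel_class h"
    using fixed W by (simp add: siegel_action_def h siegel_class_translate[OF E h(1)])
  then have "elliptic k ** h \<in> siegel_class h"
    using group.lcos_self[OF group_Sp_real _ subgroup_unitary, of "elliptic k ** h"]
      Sp_real_mult[OF E h(1)] by (simp add: Sp_real_group_def)
  then obtain u where u: "u \<in> unitary" "elliptic k ** h = h ** u"
    by (auto simp: l_coset_def Sp_real_group_def)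
  let ?B = "{axis (k, False) 1, axis (k, True) 1} :: 'a vec2 set"
  have "dim (span (systoles (matrix_inv h))) \<le> card ?B"
    using systoles_elliptic_fixed[OF h(1) u] by (intro dim_le_card span_minimal) auto
  also have "\<dots> \<le> 2"
    by (simp add: card_insert_if)
  finally show ?thesis
    by (simp add: h siegel_class_mem_systole_rank_ge)
qed

text \<open>A model has a fixed point by definition; for a deformation retract, one in Siegel space
  must be found first and then moved by the retraction.\<close>

lemma elliptic_fixed_point_exists:
  "\<exists>x\<in>siegel_space. siegel_action siegel_space (elliptic k) x = x"
proof -
  \<comment> \<open>This value gives the blocks of \<open>h\<close> outside position
    \<open>k\<close> determinant 1.\<close>
  define t where "t = sqrt (sqrt 3 / 2)"
  have t: "t * t = sqrt 3 / 2" by (simp add: t_def)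
  have t0: "t \<noteq> 0" by (simp add: t_def)
  \<comment> \<open>Outside position \<open>k\<close>, the columns of the inverse block are the
    hexagonal basis, 1 and the sixth root of unity at angle \<open>pi / 3\<close>, scaled by
    \<open>2 * t / sqrt 3\<close>. In this basis \<open>elliptic k\<close> becomes the rotation
    \<open>u\<close>.\<close>
  define h where "h = block_diag (\<lambda>i. if i = k then 1 else t) (\<lambda>i. if i = k then 0 else - t / sqrt 3)
    (\<lambda>i. 0) (\<lambda>i. if i = k then 1 else 2 * t / sqrt 3)"
  define u where "u = rotations (\<lambda>i. if i = k then pi / 2 else pi / 3)"
  have h: "h \<in> Sp_real"
    unfolding h_def by (rule block_diag_in_Sp_real) (use t in simp)
  have E: "elliptic k \<in> Sp_real"
    using elliptic_Sp_int by (auto simp: Sp_int_def)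
  have "elliptic k ** h = h ** u"
    unfolding elliptic_def h_def u_def rotations_def block_diag_mult
    by (rule block_diag_cong) (simp add: cos_60 sin_60 field_simps)
  moreover have u: "u \<in> unitary"
    by (simp add: u_def rotations_unitary)
  ultimately have "elliptic k ** h \<in> siegel_class h"
    by (auto simp: l_coset_def Sp_real_group_def)
  then have "siegel_class (elliptic k ** h) = siegel_class h"
    using group.l_repr_independence[OF group_Sp_real _ _ subgroup_unitary, of "elliptic k ** h" h] h
    by (simp add: Sp_real_group_def)
  with h show ?thesis
    by (intro bexI[of _ "siegel_class h"])
      (auto simp: siegel_action_def siegel_class_translate[OF E h] siegel_space_image)
qed

theorem theorem1p1:
  shows "\<not> (\<exists>W. W \<subseteq> (systole_rank_ge 3 :: ('g::finite mat2 set) set) \<and>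
               invariant_subset Sp_int_group (siegel_action siegel_space) W \<and>
               proper_classifying_space Sp_int_group
                 (subtopology siegel_topology W) (siegel_action W)) \<and>
         \<not> (\<exists>W. W \<subseteq> (systole_rank_ge 3 :: ('g::finite mat2 set) set) \<and>
               equivariant_deformation_retract Sp_int_group
                 siegel_topology (siegel_action siegel_space) W)"
proof (intro conjI notI; elim exE conjE)
  \<comment> \<open>\<open>undefined\<close> serves as an arbitrary position of the Gaussian
    summand; the index type is never empty, so this includes the case of a single block.\<close>
  let ?G = "Sp_int_group :: 'g mat2 monoid" and ?E = "elliptic undefined :: 'g mat2"
  interpret group ?G
    unfolding Sp_int_group_def
    by (rule subgroup.subgroup_is_group[OF subgroup_Sp_int group_Sp_real])
  have E: "?E \<in> carrier ?G"
    by (simp add: Sp_int_group_def elliptic_Sp_int)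
  {
    fix W :: "'g mat2 set set"
    assume W: "W \<subseteq> systole_rank_ge 3"
      and "proper_classifying_space ?G (subtopology siegel_topology W) (siegel_action W)"
    moreover let ?H = "carrier (subgroup_generated ?G {?E})"
    have "finite ?H"
      using finite_cyclic_subgroup[OF E] elliptic_power_12 by (metis zero_neq_numeral)
    moreover have "subgroup ?H ?G"
      by (rule subgroup_subgroup_generated)
    ultimately have "fixed_points (subtopology siegel_topology W) (siegel_action W) ?H \<noteq> {}"
      by (simp add: proper_classifying_space_def)
    then obtain x where "x \<in> fixed_points (subtopology siegel_topology W) (siegel_action W) ?H"
      by blast
    moreover have "?E \<in> ?H"
      using E by (simp add: carrier_subgroup_generated generate.incl)
    ultimately show False
      using W elliptic_fixed_not_systole_rank_ge_3[of x W] by (auto simp: fixed_points_def)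
  }
  {
    fix W :: "'g mat2 set set"
    assume W: "W \<subseteq> systole_rank_ge 3"
      and "equivariant_deformation_retract ?G siegel_topology (siegel_action siegel_space) W"
    then obtain r
      where hom: "homotopic_with (\<lambda>f. \<forall>\<gamma>\<in>carrier ?G. \<forall>x\<in>siegel_space.
            f (siegel_action siegel_space \<gamma> x) = siegel_action siegel_space \<gamma> (f x))
          siegel_topology siegel_topology id r"
        and retr: "retraction_maps siegel_topology (subtopology siegel_topology W) r id"
      unfolding equivariant_deformation_retract_def by auto
    obtain x where x: "x \<in> siegel_space" "siegel_action siegel_space ?E x = x"
      using elliptic_fixed_point_exists by blast
    \<comment> \<open>The property required along the homotopy holds at its end too, so
      \<open>r\<close> is equivariant and preserves fixed points.\<close>
    have "siegel_action siegel_space ?E (r x) = r x"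
      using homotopic_with_imp_property[OF hom] E x by fastforce
    moreover have "r x \<in> siegel_space \<inter> W"
      using retr x(1) by (auto simp: retraction_maps_def continuous_map_def)
    ultimately show False
      using W elliptic_fixed_not_systole_rank_ge_3[of "r x" siegel_space] by blast
  }
qed

end
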